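(* Let $k\ge 1$ be a fixed integer. The number of rectangular alternating sign matrices of size $k\times n$, for integers $n\ge k$, is given by a polynomial in $n$ of degree $\binom{k+1}{2}$ with leading coefficient $\prod_{i=0}^{k-1}\frac{(2i)!}{(k+i)!}$.
   Context: For $k\le n$, a (rectangular) alternating sign matrix of size $k\times n$ is a $k\times n$ matrix with entries in $\{-1,0,1\}$ such that: in each row and each column the non-zero entries alternate in sign; the leftmost non-zero entry in every row and the bottommost non-zero entry in every column (if any) is $1$; there are no zero rows, and the rightmost non-zero entry in every row is $1$; and, if $k=n$, additionally there are no zero columns and the topmost non-zero entry in every column is $1$. *)

theory Defs
  imports Complex_Main "HOL-Computational_Algebra.Polynomial" "Jordan_Normal_Form.Matrix"
begin

definition nonzero_entries :: "int vec \<Rightarrow> int list" where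
  "nonzero_entries v = filter (\<lambda>x. x \<noteq> 0) (list_of_vec v)"

definition alternates_in_sign :: "int list \<Rightarrow> bool" where
  "alternates_in_sign xs \<longleftrightarrow> successively (\<lambda>x y. sgn y = - sgn x) xs"

text \<open>
  Rows are indexed from top to bottom and columns from left to right, so the last element of
  \<open>nonzero_entries (col A j)\<close> is the bottommost non-zero entry of column \<open>j\<close>. The notion is
  meant for \<open>k \<le> n\<close>.
\<close>

definition rectangular_asm :: "nat \<Rightarrow> nat \<Rightarrow> int mat \<Rightarrow> bool" where
  "rectangular_asm k n A \<longleftrightarrow>
     A \<in> carrier_mat k n \<and>
     (\<forall>i<k. \<forall>j<n. A $$ (i, j) \<in> {-1, 0, 1}) \<and>
     (\<forall>i<k. let r = nonzero_entries (row A i) in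
        alternates_in_sign r \<and> r \<noteq> [] \<and> hd r = 1 \<and> last r = 1) \<and>
     (\<forall>j<n. let c = nonzero_entries (col A j) in
        alternates_in_sign c \<and> (c \<noteq> [] \<longrightarrow> last c = 1) \<and>
        (k = n \<longrightarrow> c \<noteq> [] \<and> hd c = 1))"

end

theory Submission
  imports Defs
begin

text \<open>
  Read the matrix from left to right. After \<open>j\<close> columns the rows with prefix sum \<open>1\<close> form a set
  \<open>S\<^sub>j\<close>, and the matrix becomes a walk of length \<open>n\<close> from the empty set to the set of all rows; zero
  columns are steps that stay in place. Counting each row \<open>x\<close> (from \<open>0\<close> at the top) with
  weight \<open>x + 1\<close>, every other step raises the weight, and the steps raising it by exactly \<open>1\<close> are the
  additions of a box to a strict partition (the one with parts \<open>x + 1\<close> for \<open>x\<close> in \<open>S\<close>). Hence the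
  forward difference in \<open>n\<close> of the number of walks to \<open>S\<close> is a sum of numbers of walks to sets of
  smaller weight, and induction shows that this number is a polynomial of degree the weight of \<open>S\<close>,
  whose leading coefficient satisfies the recurrence of Thrall's product formula for shifted standard
  tableaux. That the product formula satisfies this recurrence is an instance of Lagrange interpolation.
\<close>

section \<open>Polynomials\<close>

text \<open>A suitable multiple of the monomial of degree \<open>Suc d\<close> has a forward
  difference that agrees with \<open>q\<close> in degree \<open>d\<close>; what remains has smaller
  degree and is handled by induction. The value at \<open>0\<close> is free because constants have
  zero difference.\<close>

lemma forward_difference_surj:
  fixes q :: "'a::field_char_0 poly"
  assumes "degree q \<le> d"
  shows "\<exists>p. degree p \<le> Suc d \<and> coeff p (Suc d) * of_nat (Suc d) = coeff q d \<and> poly p 0 = c \<and>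
           (\<forall>x. poly p (x + 1) - poly p x = poly q x)"
  using assms
proof (induction d arbitrary: q c rule: less_induct)
  case (less d)
  define m where "m = monom (coeff q d / of_nat (Suc d)) (Suc d)"
  \<comment> \<open>\<open>D\<close> is the forward difference of \<open>m\<close>, written so that
    its coefficients can be read off; the terms of degree \<open>Suc d\<close> cancel.\<close>
  define D where "D = Polynomial.smult (coeff q d / of_nat (Suc d)) ([:1, 1:] ^ Suc d) - m"
  have coeffD: "coeff D d = coeff q d"
    by (simp add: D_def m_def coeff_linear_poly_power del: power_Suc of_nat_Suc)
  have degD: "degree D \<le> d"
  proof (rule degree_le, intro allI impI)
    fix i assume i: "d < i"
    show "coeff D i = 0"
    proof (cases "i = Suc d")
      case True
      then show ?thesis
        by (simp add: D_def m_def coeff_linear_power del: power_Suc of_nat_Suc)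
    next
      case False
      then have "degree ([:1, 1::'a:] ^ Suc d) < i"
        using i by (simp add: degree_linear_power del: power_Suc)
      then show ?thesis
        using False by (simp add: D_def m_def coeff_eq_0 del: power_Suc of_nat_Suc)
    qed
  qed
  have polyD: "poly D x = poly m (x + 1) - poly m x" for x
    by (simp add: D_def m_def poly_monom poly_power add.commute del: power_Suc of_nat_Suc)
  have degm: "degree m \<le> Suc d"
    unfolding m_def by (rule degree_monom_le)
  have coeffm: "coeff m (Suc d) * of_nat (Suc d) = coeff q d"
    by (simp add: m_def del: of_nat_Suc)
  have polym: "poly m 0 = 0"
    by (simp add: m_def poly_monom)
  have coeff_rest: "coeff (q - D) i = 0" if "d \<le> i" for i
    using that coeffD degD less.prems by (cases "i = d") (auto simp: coeff_eq_0)
  show ?case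
  proof (cases d)
    case 0
    then have "q - D = 0"
      using coeff_rest by (intro poly_eqI) simp
    then show ?thesis
      using degm coeffm polym polyD
      by (intro exI[of _ "m + [:c:]"]) (auto intro!: degree_add_le simp: coeff_pCons 0)
  next
    case (Suc e)
    have "degree (q - D) \<le> e"
      using coeff_rest Suc by (intro degree_le) auto
    from less.IH[OF _ this, of c] Suc obtain p where p: "degree p \<le> Suc e" "poly p 0 = c"
      "\<And>x. poly p (x + 1) - poly p x = poly (q - D) x"
      by auto
    have "coeff p (Suc d) = 0"
      using p(1) Suc by (intro coeff_eq_0) simp
    moreover have "poly (m + p) (x + 1) - poly (m + p) x = poly q x" for x
    proof -
      have "poly (m + p) (x + 1) - poly (m + p) x = poly D x + poly (q - D) x"
        unfolding polyD p(3)[symmetric] by simp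
      then show ?thesis
        by simp
    qed
    ultimately show ?thesis
      using degm coeffm polym p(1,2) Suc
      by (intro exI[of _ "m + p"]) (auto intro!: degree_add_le simp: algebra_simps)
  qed
qed

section \<open>Monic products and Lagrange interpolation\<close>

lemma degree_prod_linear_factors_le:
  fixes u :: "'b \<Rightarrow> 'a::comm_ring_1"
  assumes "finite S"
  shows "degree (\<Prod>x\<in>S. [:- u x, 1:]) \<le> card S"
  using degree_prod_sum_le[OF assms, of "\<lambda>x. [:- u x, 1:]"] by simp

lemma coeff_prod_linear_factors_card:
  fixes u :: "'b \<Rightarrow> 'a::comm_ring_1"
  assumes "finite S"
  shows "coeff (\<Prod>x\<in>S. [:- u x, 1:]) (card S) = 1"
  using assms
proof (induction S)
  case (insert x T)
  then show ?case
    using degree_prod_linear_factors_le[of T u] by (simp add: coeff_eq_0)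
qed simp

lemma coeff_prod_linear_factors_card_minus_1:
  fixes u :: "'b \<Rightarrow> 'a::comm_ring_1"
  assumes "finite S" "S \<noteq> {}"
  shows "coeff (\<Prod>x\<in>S. [:- u x, 1:]) (card S - 1) = - (\<Sum>x\<in>S. u x)"
  using assms
proof (induction S rule: finite_ne_induct)
  case (insert x T)
  moreover obtain c where "card T = Suc c"
    using insert.hyps by (cases "card T") auto
  ultimately show ?case
    using coeff_prod_linear_factors_card[of T u] by simp
qed simp

text \<open>Since \<open>degree Q < card S\<close>, \<open>Q\<close> is its own interpolant at the
  distinct nodes \<open>u x\<close>. The unnormalised basis polynomials are monic of degree
  \<open>card S - 1\<close>, so comparing coefficients in that degree gives the sum.\<close>

lemma lagrange_coeff:
  fixes u :: "'b \<Rightarrow> 'a::field"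
  assumes "finite S" "inj_on u S" "degree Q < card S"
  shows "(\<Sum>x\<in>S. poly Q (u x) / (\<Prod>y\<in>S - {x}. u x - u y)) = coeff Q (card S - 1)"
proof -
  define l where "l x = (\<Prod>y\<in>S - {x}. [:- u y, 1:])" for x
  define R where
    "R = (\<Sum>x\<in>S. Polynomial.smult (poly Q (u x) / (\<Prod>y\<in>S - {x}. u x - u y)) (l x))"
  have degl: "degree (l x) \<le> card S - 1" if "x \<in> S" for x
    using degree_prod_sum_le[of "S - {x}" "\<lambda>x. [:- u x, 1:]"] assms that by (simp add: l_def)
  have "degree R \<le> card S - 1"
    unfolding R_def using assms degl
    by (intro degree_sum_le) (auto intro!: order_trans[OF degree_smult_le])
  moreover have "poly R (u z) = poly Q (u z)" if "z \<in> S" for z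
  proof -
    have "poly (l x) (u z) = (if x = z then (\<Prod>y\<in>S - {z}. u z - u y) else 0)" for x
      using that assms by (auto simp: l_def poly_prod)
    moreover have "(\<Prod>y\<in>S - {z}. u z - u y) \<noteq> 0"
      using that assms by (auto simp: inj_on_def)
    ultimately show ?thesis
      using that assms by (auto simp: R_def poly_sum if_distrib[of "\<lambda>t. _ * t"] cong: if_cong)
  qed
  moreover have "card (u ` S) = card S"
    using assms by (simp add: card_image)
  ultimately have "R = Q"
    using assms by (intro poly_eqI_degree[of "u ` S"]) auto
  moreover have "coeff (l x) (card S - 1) = 1" if "x \<in> S" for x
    using coeff_prod_linear_factors_card[of "S - {x}" u] assms that by (simp add: l_def)
  then have "coeff R (card S - 1) = (\<Sum>x\<in>S. poly Q (u x) / (\<Prod>y\<in>S - {x}. u x - u y))"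
    by (simp add: R_def coeff_sum)
  ultimately show ?thesis
    by simp
qed

lemma sum_prod_diff_quotients:
  fixes u v :: "'b \<Rightarrow> 'a::field"
  assumes "finite S" "inj_on u S"
  shows "(\<Sum>x\<in>S. (\<Prod>y\<in>S. u x - v y) / (\<Prod>y\<in>S - {x}. u x - u y)) = (\<Sum>x\<in>S. u x - v x)"
proof (cases "S = {}")
  case False
  \<comment> \<open>Subtracting the polynomial that vanishes at all nodes changes no value there and
    cancels the leading term, so interpolation applies; the next coefficient is the difference of
    the sums of roots.\<close>
  define Q where "Q = (\<Prod>y\<in>S. [:- v y, 1:]) - (\<Prod>y\<in>S. [:- u y, 1:])"
  have deg: "degree (\<Prod>y\<in>S. [:- w y, 1:]) \<le> card S" for w :: "'b \<Rightarrow> 'a"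
    using assms(1) by (rule degree_prod_linear_factors_le)
  have "coeff Q (card S) = 0"
    using assms by (simp add: Q_def coeff_prod_linear_factors_card)
  moreover have "degree Q \<le> card S"
    unfolding Q_def by (intro degree_diff_le deg)
  moreover have "card S > 0"
    using False assms by (simp add: card_gt_0_iff)
  ultimately have "degree Q < card S"
    by (metis gr_zeroI le_neq_implies_less leading_coeff_0_iff degree_0)
  from lagrange_coeff[OF assms this]
  have "(\<Sum>x\<in>S. poly Q (u x) / (\<Prod>y\<in>S - {x}. u x - u y)) = coeff Q (card S - 1)" .
  moreover have "poly Q (u x) = (\<Prod>y\<in>S. u x - v y)" if "x \<in> S" for x
    using that assms by (auto simp: Q_def poly_prod)
  ultimately show ?thesis
    using coeff_prod_linear_factors_card_minus_1[OF assms(1) False, of u]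
      coeff_prod_linear_factors_card_minus_1[OF assms(1) False, of v]
    by (simp add: Q_def sum_subtractf)
qed simp

section \<open>Steps between sets of rows\<close>

text \<open>For the partition with parts \<open>x + 1\<close> this is the number of parts exceeding
  \<open>i\<close>, a column length of its diagram.\<close>

definition tail_card :: "nat set \<Rightarrow> nat \<Rightarrow> nat" where
  "tail_card S i = card {x \<in> S. i \<le> x}"

text \<open>The matrix column between \<open>T\<close> and \<open>S\<close> is the difference of
  their indicators; its sums from the bottom are differences of tail counts and must be
  \<open>0\<close> or \<open>1\<close>. Finiteness is demanded because \<open>card\<close> is
  \<open>0\<close> on infinite sets.\<close>

definition step :: "nat set \<Rightarrow> nat set \<Rightarrow> bool" where
  "step T S \<longleftrightarrow> finite T \<and> finite S \<and>
     (\<forall>i. tail_card S i = tail_card T i \<or> tail_card S i = tail_card T i + 1)"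

definition weight :: "nat set \<Rightarrow> nat" where
  "weight S = (\<Sum>x\<in>S. Suc x)"

lemma tail_card_Suc:
  assumes "finite S"
  shows "tail_card S i = tail_card S (Suc i) + of_bool (i \<in> S)"
proof (cases "i \<in> S")
  case True
  then have "{x \<in> S. i \<le> x} = insert i {x \<in> S. Suc i \<le> x}"
    by auto
  then show ?thesis
    using True assms by (simp add: tail_card_def)
next
  case False
  then have "{x \<in> S. i \<le> x} = {x \<in> S. Suc i \<le> x}"
    by (auto simp: Suc_le_eq order_less_le)
  then show ?thesis
    using False by (simp add: tail_card_def)
qed

lemma tail_card_eq_0_iff: "finite S \<Longrightarrow> tail_card S i = 0 \<longleftrightarrow> S \<subseteq> {..<i}"
  by (auto simp: tail_card_def not_le)

text \<open>Double counting: \<open>x\<close> lies in the tails that start at \<open>0\<close> up to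
  \<open>x\<close>.\<close>

lemma sum_tail_card:
  assumes "S \<subseteq> {..<k}"
  shows "(\<Sum>i<k. tail_card S i) = weight S"
proof -
  have fin: "finite S"
    using assms by (rule finite_subset) simp
  have "(\<Sum>i<k. tail_card S i) = (\<Sum>i<k. \<Sum>x\<in>S. of_bool (i \<le> x))"
    using fin by (simp add: tail_card_def sum_of_bool_eq Int_def conj_commute)
  also have "\<dots> = (\<Sum>x\<in>S. \<Sum>i<k. of_bool (i \<le> x))"
    by (rule sum.swap)
  also have "\<dots> = (\<Sum>x\<in>S. Suc x)"
  proof (rule sum.cong)
    fix x assume "x \<in> S"
    then have "{..<k} \<inter> {i. i \<le> x} = {..x}"
      using assms by auto
    then show "(\<Sum>i<k. of_bool (i \<le> x)) = Suc x"
      by (simp add: sum_of_bool_eq)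
  qed simp
  finally show ?thesis
    by (simp add: weight_def)
qed

text \<open>A vanishing tail count at \<open>k\<close> means that all elements are below
  \<open>k\<close>, and a step never lowers a tail count.\<close>

lemma step_subset: "step T S \<Longrightarrow> S \<subseteq> {..<k} \<Longrightarrow> T \<subseteq> {..<k}"
  by (metis step_def tail_card_eq_0_iff add_is_0)

lemma finite_step: "finite {T. step T S}"
proof (cases "finite S")
  case True
  then obtain k where "S \<subseteq> {..<k}"
    using finite_nat_iff_bounded by blast
  then have "{T. step T S} \<subseteq> Pow {..<k}"
    using step_subset by blast
  then show ?thesis
    by (rule finite_subset) simp
qed (simp add: step_def)

text \<open>Membership of \<open>i\<close> shows in the drop of the tail count from \<open>i\<close>
  to \<open>Suc i\<close>.\<close>

lemma tail_card_inj:
  assumes "finite S" "finite T" "\<And>i. tail_card S i = tail_card T i"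
  shows "S = T"
proof (rule Set.set_eqI)
  fix i
  show "i \<in> S \<longleftrightarrow> i \<in> T"
    using tail_card_Suc[OF assms(1), of i] tail_card_Suc[OF assms(2), of i]
      assms(3)[of i] assms(3)[of "Suc i"]
    by (cases "i \<in> S"; cases "i \<in> T") simp_all
qed

lemma step_refl: "finite S \<Longrightarrow> step S S"
  by (simp add: step_def)

text \<open>Tail counts add up to the weight, and every index at which they differ contributes
  exactly \<open>1\<close>.\<close>

lemma weight_eq_add_card:
  assumes "step T S" "S \<subseteq> {..<k}"
  shows "weight S = weight T + card {i. tail_card S i \<noteq> tail_card T i}"
    and "finite {i. tail_card S i \<noteq> tail_card T i}"
proof -
  have T: "T \<subseteq> {..<k}"
    using assms by (rule step_subset)
  have fin: "finite T" "finite S"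
    using assms by (auto simp: step_def)
  have "tail_card S i = tail_card T i" if "k \<le> i" for i
  proof -
    have "tail_card S i = 0" "tail_card T i = 0"
      using that fin assms(2) T by (subst tail_card_eq_0_iff; fastforce)+
    then show ?thesis
      by simp
  qed
  then have sub: "{i. tail_card S i \<noteq> tail_card T i} \<subseteq> {..<k}"
    by (auto simp: not_le[symmetric])
  then show "finite {i. tail_card S i \<noteq> tail_card T i}"
    by (rule finite_subset) simp
  have "weight S = (\<Sum>i<k. tail_card T i + of_bool (tail_card S i \<noteq> tail_card T i))"
    unfolding sum_tail_card[OF assms(2), symmetric]
    using assms(1) by (intro sum.cong) (auto simp: step_def)
  also have "\<dots> = weight T + card {i. tail_card S i \<noteq> tail_card T i}"
    using sub by (simp add: sum.distrib sum_tail_card[OF T] sum_of_bool_eq Int_absorb1)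
  finally show "weight S = weight T + card {i. tail_card S i \<noteq> tail_card T i}" .
qed

lemma weight_less:
  assumes "step T S" "T \<noteq> S"
  shows "weight T < weight S"
proof -
  have fin: "finite T" "finite S"
    using assms by (auto simp: step_def)
  then obtain k where k: "S \<subseteq> {..<k}"
    using finite_nat_iff_bounded by blast
  have "{i. tail_card S i \<noteq> tail_card T i} \<noteq> {}"
    using tail_card_inj[OF fin] assms(2) by fastforce
  then show ?thesis
    using weight_eq_add_card[OF assms(1) k] by (simp add: card_gt_0_iff)
qed

text \<open>For \<open>x = 0\<close> the element is removed altogether: a part of size \<open>1\<close> disappears.\<close>

definition dec :: "nat set \<Rightarrow> nat \<Rightarrow> nat set" where
  "dec S x = (S - {x}) \<union> {y. Suc y = x}"

text \<open>These are the parts that can lose a box with the partition staying strict.\<close>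

definition removable :: "nat set \<Rightarrow> nat set" where
  "removable S = {x \<in> S. \<forall>y\<in>S. Suc y \<noteq> x}"

lemma finite_dec: "finite S \<Longrightarrow> finite (dec S x)"
  by (cases x) (auto simp: dec_def)

text \<open>Moving \<open>x\<close> down by one is visible only in the tail starting at
  \<open>x\<close>: longer tails contain the element before and after the move, shorter ones at
  neither time.\<close>

lemma tail_card_dec:
  assumes "finite S" "x \<in> removable S"
  shows "tail_card S i = tail_card (dec S x) i + of_bool (i = x)"
proof -
  have S: "x \<in> S" "\<And>y. y \<in> S \<Longrightarrow> Suc y \<noteq> x"
    using assms(2) by (auto simp: removable_def)
  consider "i = x" | "i > x" | "i < x"
    by linarith
  then show ?thesis
  proof cases
    case 1
    have "{y \<in> S. x \<le> y} = insert x {y \<in> dec S x. x \<le> y}" "x \<notin> dec S x"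
      using S by (auto simp: dec_def)
    then show ?thesis
      using 1 finite_dec[OF assms(1), of x] by (simp add: tail_card_def)
  next
    case 2
    then have "{y \<in> S. i \<le> y} = {y \<in> dec S x. i \<le> y}"
      using S by (auto simp: dec_def)
    then show ?thesis
      using 2 by (simp add: tail_card_def)
  next
    case 3
    then obtain z where z: "x = Suc z"
      by (cases x) auto
    define R where "R = {y \<in> S - {x}. i \<le> y}"
    have "{y \<in> S. i \<le> y} = insert x R" "{y \<in> dec S x. i \<le> y} = insert z R"
      using S 3 z by (auto simp: dec_def R_def)
    moreover have "finite R" "x \<notin> R" "z \<notin> R"
      using S z assms by (auto simp: R_def)
    ultimately show ?thesis
      using 3 by (simp add: tail_card_def)
  qed
qed

lemma inj_on_dec:
  assumes "finite S"
  shows "inj_on (dec S) (removable S)"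
proof (rule inj_onI)
  fix x y assume "x \<in> removable S" "y \<in> removable S" "dec S x = dec S y"
  then show "x = y"
    using tail_card_dec[OF assms, of x x] tail_card_dec[OF assms, of y x]
    by (cases "x = y") simp_all
qed

text \<open>If the weight rises by one, the tail counts differ at a single index \<open>x\<close>,
  and tail counts determine the set.\<close>

lemma step_weight_Suc_eq:
  assumes "finite S"
  shows "{T. step T S \<and> weight S = Suc (weight T)} = dec S ` removable S"
proof (intro equalityI subsetI)
  obtain k where k: "S \<subseteq> {..<k}"
    using assms finite_nat_iff_bounded by blast
  fix T assume "T \<in> {T. step T S \<and> weight S = Suc (weight T)}"
  then have T: "step T S" "weight S = Suc (weight T)"
    by auto
  then have fin: "finite T"
    by (simp add: step_def)
  from T weight_eq_add_card(1)[OF T(1) k]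
  have "card {i. tail_card S i \<noteq> tail_card T i} = 1"
    by simp
  then obtain x where x: "{i. tail_card S i \<noteq> tail_card T i} = {x}"
    using card_1_singletonE by blast
  then have h: "tail_card S i = tail_card T i + of_bool (i = x)" for i
    using T(1) by (auto simp: step_def)
  \<comment> \<open>For \<open>i = x\<close> this yields \<open>x \<in> S\<close>, and for
    \<open>Suc i = x\<close> it yields \<open>i \<notin> S\<close>.\<close>
  have mem: "of_bool (i \<in> S) + of_bool (Suc i = x) = of_bool (i \<in> T) + (of_bool (i = x) :: nat)" for i
    using tail_card_Suc[OF assms, of i] tail_card_Suc[OF fin, of i] h[of i] h[of "Suc i"]
    by simp
  have "x \<in> removable S"
    unfolding removable_def
  proof (intro CollectI conjI ballI notI)
    show "x \<in> S"
      using mem[of x] by (cases "x \<in> S"; cases "x \<in> T") simp_all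
    show False if "y \<in> S" "Suc y = x" for y
      using mem[of y] that by (cases "y \<in> T") simp_all
  qed
  moreover have "T = dec S x"
  proof (rule tail_card_inj)
    show "tail_card T i = tail_card (dec S x) i" for i
      using h[of i] tail_card_dec[OF assms calculation, of i] by simp
  qed (use fin assms in \<open>auto intro: finite_dec\<close>)
  ultimately show "T \<in> dec S ` removable S"
    by blast
next
  obtain k where k: "S \<subseteq> {..<k}"
    using assms finite_nat_iff_bounded by blast
  fix T assume "T \<in> dec S ` removable S"
  then obtain x where x: "T = dec S x" "x \<in> removable S"
    by blast
  note h = tail_card_dec[OF assms x(2), folded x(1)]
  have step: "step T S"
    unfolding step_def using assms x(1) h by (simp add: finite_dec)
  moreover have "{i. tail_card S i \<noteq> tail_card T i} = {x}"
    using h by auto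
  ultimately show "T \<in> {T. step T S \<and> weight S = Suc (weight T)}"
    using weight_eq_add_card(1)[OF step k] by simp
qed

section \<open>The product formula\<close>

text \<open>
  Thrall's formula \<open>\<Prod>\<^sub>i 1/\<lambda>\<^sub>i! \<Prod>\<^sub>i\<^sub><\<^sub>j (\<lambda>\<^sub>i - \<lambda>\<^sub>j)/(\<lambda>\<^sub>i + \<lambda>\<^sub>j)\<close> for the parts \<open>\<lambda> = x + 1\<close>.
\<close>

definition hook_coeff :: "nat set \<Rightarrow> real" where
  "hook_coeff S = (\<Prod>x\<in>S. 1 / fact (Suc x)) *
     (\<Prod>(x, y)\<in>{(x, y) \<in> S \<times> S. y < x}. (real x - real y) / (real x + real y + 2))"

section \<open>Changing one part in the product formula\<close>

text \<open>The absolute value merges the pairs in which \<open>x\<close> is the larger element with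
  those in which it is the smaller.\<close>

lemma hook_coeff_insert:
  assumes "finite R" "x \<notin> R"
  shows "hook_coeff (insert x R) =
    hook_coeff R / fact (Suc x) * (\<Prod>y\<in>R. \<bar>real x - real y\<bar> / (real x + real y + 2))"
proof -
  define f where "f = (\<lambda>(x, y). (real x - real y) / (real x + real y + 2))"
  define P where "P = {(a, b) \<in> R \<times> R. b < a}"
  have "{(a, b) \<in> insert x R \<times> insert x R. b < a} =
      P \<union> (Pair x ` {y \<in> R. y < x} \<union> (\<lambda>y. (y, x)) ` {y \<in> R. \<not> y < x})"
    using assms(2) by (auto simp: P_def not_less order_less_le)
  moreover have "finite P"
    unfolding P_def by (rule finite_subset[of _ "R \<times> R"]) (use assms in auto)
  moreover have "prod f (Pair x ` {y \<in> R. y < x}) =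
      (\<Prod>y\<in>{y \<in> R. y < x}. \<bar>real x - real y\<bar> / (real x + real y + 2))"
    by (subst prod.reindex) (auto simp: inj_on_def f_def intro!: prod.cong)
  moreover have "prod f ((\<lambda>y. (y, x)) ` {y \<in> R. \<not> y < x}) =
      (\<Prod>y\<in>{y \<in> R. \<not> y < x}. \<bar>real x - real y\<bar> / (real x + real y + 2))"
    by (subst prod.reindex) (auto simp: inj_on_def f_def add.commute intro!: prod.cong)
  moreover have "(\<Prod>y\<in>R. \<bar>real x - real y\<bar> / (real x + real y + 2)) =
      (\<Prod>y\<in>{y \<in> R. y < x}. \<bar>real x - real y\<bar> / (real x + real y + 2)) *
      (\<Prod>y\<in>{y \<in> R. \<not> y < x}. \<bar>real x - real y\<bar> / (real x + real y + 2))"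
    using assms(1) by (subst prod.union_disjoint[symmetric]) (auto intro!: prod.cong)
  moreover have "prod f (P \<union> (Pair x ` {y \<in> R. y < x} \<union> (\<lambda>y. (y, x)) ` {y \<in> R. \<not> y < x})) =
      prod f P * (prod f (Pair x ` {y \<in> R. y < x}) *
        prod f ((\<lambda>y. (y, x)) ` {y \<in> R. \<not> y < x}))"
  proof (subst prod.union_disjoint)
    show "finite P" by fact
    show "P \<inter> (Pair x ` {y \<in> R. y < x} \<union> (\<lambda>y. (y, x)) ` {y \<in> R. \<not> y < x}) = {}"
      using assms(2) by (auto simp: P_def)
    show "prod f P * prod f (Pair x ` {y \<in> R. y < x} \<union> (\<lambda>y. (y, x)) ` {y \<in> R. \<not> y < x}) =
      prod f P * (prod f (Pair x ` {y \<in> R. y < x}) *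
        prod f ((\<lambda>y. (y, x)) ` {y \<in> R. \<not> y < x}))"
      using assms by (subst prod.union_disjoint) auto
  qed (use assms in auto)
  ultimately have "prod f {(a, b) \<in> insert x R \<times> insert x R. b < a} =
      prod f P * (\<Prod>y\<in>R. \<bar>real x - real y\<bar> / (real x + real y + 2))"
    by simp
  then show ?thesis
    using assms by (simp add: hook_coeff_def f_def P_def)
qed

lemma hook_coeff_dec:
  assumes "finite S" "x \<in> removable S"
  shows "hook_coeff (dec S x) = hook_coeff S * (real x + 1) *
    (\<Prod>y\<in>S - {x}. ((real x + real y + 2) * (real x - real y - 1)) /
                     ((real x - real y) * (real x + real y + 1)))"
proof -
  define R where "R = S - {x}"
  have R: "finite R" "x \<notin> R" "S = insert x R" "\<And>y. y \<in> R \<Longrightarrow> Suc y \<noteq> x"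
    using assms by (auto simp: R_def removable_def)
  have hS: "hook_coeff S =
      hook_coeff R / fact (Suc x) * (\<Prod>y\<in>R. \<bar>real x - real y\<bar> / (real x + real y + 2))"
    using hook_coeff_insert[OF R(1,2)] R(3) by simp
  show ?thesis
  proof (cases x)
    case 0
    have "dec S x = R"
      using 0 by (auto simp: dec_def R_def)
    \<comment> \<open>The removed \<open>0\<close> leaves no factors behind, so the quotients have
      to cancel its factors in \<open>hook_coeff S\<close> exactly.\<close>
    moreover have "(\<Prod>y\<in>R. \<bar>real x - real y\<bar> / (real x + real y + 2)) *
       (\<Prod>y\<in>R. ((real x + real y + 2) * (real x - real y - 1)) /
                     ((real x - real y) * (real x + real y + 1))) = 1"
      unfolding prod.distrib[symmetric]
    proof (intro prod.neutral ballI)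
      fix y assume "y \<in> R"
      then have "y > 0"
        using R(2) 0 by (cases y) auto
      then show "\<bar>real x - real y\<bar> / (real x + real y + 2) *
         (((real x + real y + 2) * (real x - real y - 1)) /
                     ((real x - real y) * (real x + real y + 1))) = 1"
        using 0 by (simp add: divide_simps)
    qed
    ultimately show ?thesis
      unfolding hS R_def[symmetric] using 0 by simp
  next
    case (Suc z)
    have "z \<notin> R"
      using Suc R(4)[of z] by blast
    moreover have "dec S x = insert z R"
      using Suc by (auto simp: dec_def R_def)
    ultimately have hd: "hook_coeff (dec S x) =
        hook_coeff R / fact (Suc z) * (\<Prod>y\<in>R. \<bar>real z - real y\<bar> / (real z + real y + 2))"
      using hook_coeff_insert[OF R(1)] by simp
    have "(\<Prod>y\<in>R. \<bar>real z - real y\<bar> / (real z + real y + 2)) =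
      (\<Prod>y\<in>R. \<bar>real x - real y\<bar> / (real x + real y + 2)) *
       (\<Prod>y\<in>R. ((real x + real y + 2) * (real x - real y - 1)) /
                     ((real x - real y) * (real x + real y + 1)))"
      unfolding prod.distrib[symmetric]
    proof (rule prod.cong)
      fix y assume "y \<in> R"
      then have "y \<noteq> x" "y \<noteq> z"
        using R(2) \<open>z \<notin> R\<close> by auto
      \<comment> \<open>No \<open>y\<close> lies strictly between \<open>z\<close> and
        \<open>x\<close>, so \<open>x - y\<close> and \<open>z - y\<close> have the same sign and
        the absolute values cancel.\<close>
      then consider "y < z" | "y > x"
        using Suc by linarith
      then show "\<bar>real z - real y\<bar> / (real z + real y + 2) =
         \<bar>real x - real y\<bar> / (real x + real y + 2) *
         (((real x + real y + 2) * (real x - real y - 1)) /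
                     ((real x - real y) * (real x + real y + 1)))"
      proof cases
        case 1
        then have "real x - real y > 0" "real z - real y > 0"
          using Suc by auto
        then show ?thesis
          using Suc by (simp add: divide_simps)
      next
        case 2
        then have "real x - real y < 0" "real z - real y < 0"
          using Suc by auto
        then show ?thesis
          using Suc by (simp add: divide_simps) (simp add: algebra_simps)
      qed
    qed simp
    then show ?thesis
      unfolding hS hd R_def[symmetric] using Suc by (simp add: divide_simps)
  qed
qed

text \<open>
  In terms of the parts \<open>t = x + 1\<close>, the factors of \<open>hook_coeff_dec\<close> are quotients of differences of the
  values \<open>u = t\<^sup>2 - t\<close> and \<open>v = t\<^sup>2 + t\<close>, so that the sum is an interpolation sum; its terms
  for non-removable \<open>x\<close> vanish.
\<close>

lemma sum_hook_coeff_dec: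
  assumes "finite S"
  shows "(\<Sum>x\<in>removable S. hook_coeff (dec S x)) = real (weight S) * hook_coeff S"
proof -
  define u where "u x = (real x + 1) ^ 2 - (real x + 1)" for x
  define v where "v x = (real x + 1) ^ 2 + (real x + 1)" for x
  have uu: "u x - u y = (real x - real y) * (real x + real y + 1)" for x y
    by (simp add: u_def power2_eq_square algebra_simps)
  have uv: "u x - v y = (real x + real y + 2) * (real x - real y - 1)" for x y
    by (simp add: u_def v_def power2_eq_square algebra_simps)
  have inj: "inj_on u S"
  proof (rule inj_onI)
    fix x y assume "u x = u y"
    then have "(real x - real y) * (real x + real y + 1) = 0"
      using uu[of x y] by simp
    moreover have "real x + real y + 1 > 0"
      by simp
    ultimately show "x = y"
      by simp
  qed
  have "(\<Sum>x\<in>S. u x - v x) = - 2 * (\<Sum>x\<in>S. real x + 1)"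
    unfolding sum_distrib_left by (simp add: u_def v_def)
  then have weight: "(\<Sum>x\<in>S. u x - v x) = - 2 * real (weight S)"
    by (simp add: weight_def add.commute)
  \<comment> \<open>The numerator's factor for \<open>y = x\<close> is
    \<open>u x - v x = - 2 * (x + 1)\<close>.\<close>
  have *: "(\<Prod>y\<in>S. u x - v y) / (\<Prod>y\<in>S - {x}. u x - u y) =
      - 2 * ((real x + 1) * (\<Prod>y\<in>S - {x}. (u x - v y) / (u x - u y)))" if "x \<in> S" for x
    using that assms by (subst prod.remove[of S x]) (auto simp: prod_dividef uv algebra_simps)
  have "(\<Sum>x\<in>removable S. hook_coeff (dec S x)) =
     (\<Sum>x\<in>removable S. hook_coeff S * ((real x + 1) * (\<Prod>y\<in>S - {x}. (u x - v y) / (u x - u y))))"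
    using assms by (intro sum.cong) (auto simp: hook_coeff_dec uu uv)
  also have "\<dots> =
     (\<Sum>x\<in>S. hook_coeff S * ((real x + 1) * (\<Prod>y\<in>S - {x}. (u x - v y) / (u x - u y))))"
  proof (rule sum.mono_neutral_left)
    show "\<forall>x\<in>S - removable S.
       hook_coeff S * ((real x + 1) * (\<Prod>y\<in>S - {x}. (u x - v y) / (u x - u y))) = 0"
    proof
      fix x assume "x \<in> S - removable S"
      then obtain y where y: "y \<in> S" "Suc y = x"
        by (auto simp: removable_def)
      \<comment> \<open>For \<open>x = Suc y\<close> the values \<open>u x\<close> and
        \<open>v y\<close> coincide.\<close>
      then have "y \<in> S - {x}" "(u x - v y) / (u x - u y) = 0"
        by (auto simp: uv)
      then have "(\<Prod>y\<in>S - {x}. (u x - v y) / (u x - u y)) = 0"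
        using assms by (meson finite_Diff prod_zero)
      then show "hook_coeff S * ((real x + 1) * (\<Prod>y\<in>S - {x}. (u x - v y) / (u x - u y))) = 0"
        by simp
    qed
  qed (use assms in \<open>auto simp: removable_def\<close>)
  also have "\<dots> = hook_coeff S *
      (\<Sum>x\<in>S. (real x + 1) * (\<Prod>y\<in>S - {x}. (u x - v y) / (u x - u y)))"
    by (simp add: sum_distrib_left)
  also have "- 2 * (\<Sum>x\<in>S. (real x + 1) * (\<Prod>y\<in>S - {x}. (u x - v y) / (u x - u y))) =
      (\<Sum>x\<in>S. (\<Prod>y\<in>S. u x - v y) / (\<Prod>y\<in>S - {x}. u x - u y))"
    unfolding sum_distrib_left by (intro sum.cong) (auto simp: *)
  then have "(\<Sum>x\<in>S. (real x + 1) * (\<Prod>y\<in>S - {x}. (u x - v y) / (u x - u y))) = real (weight S)"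
    using sum_prod_diff_quotients[OF assms inj, of v] weight by linarith
  finally show ?thesis
    by simp
qed

section \<open>The staircase partition with parts \<open>1\<close> to \<open>k\<close>\<close>

text \<open>Induction adjoins the largest part: \<open>1\<close> evaluates its new factors, and
  \<open>2\<close> compares the denominators for \<open>k\<close> and \<open>Suc k\<close>.\<close>

lemma hook_coeff_lessThan:
  "hook_coeff {..<k} = (\<Prod>i<k. fact (2 * i) / fact (k + i))"
proof (induction k)
  case (Suc k)
  have 1: "(\<Prod>y<k. \<bar>real k - real y\<bar> / (real k + real y + 2)) = fact k * fact (Suc k) / fact (2 * k + 1)"
  proof -
    \<comment> \<open>\<open>k\<close> occurs in every factor, so the induction is on the number
      \<open>m\<close> of factors with \<open>k\<close> fixed.\<close>
    have "(\<Prod>y<m. \<bar>real k - real y\<bar> / (real k + real y + 2)) =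
       fact k / fact (k - m) * fact (Suc k) / fact (k + m + 1)" if "m \<le> k" for m
      using that
    proof (induction m)
      case (Suc m)
      then have "k - m = Suc (k - Suc m)" "real (k - m) = real k - real m" and pos: "real k - real m > 0"
        by auto
      then have f: "(fact (k - m) :: real) = (real k - real m) * fact (k - Suc m)"
        by (metis fact_Suc)
      have g: "(fact (k + Suc m + 1) :: real) = (real k + real m + 2) * fact (k + m + 1)"
        by simp
      have "(\<Prod>y<Suc m. \<bar>real k - real y\<bar> / (real k + real y + 2)) =
          fact k / fact (k - m) * fact (Suc k) / fact (k + m + 1) * ((real k - real m) / (real k + real m + 2))"
        using Suc pos by simp
      then show ?case
        unfolding f g using pos by simp
    qed simp
    from this[of k] show ?thesis
      by (simp add: mult_2[symmetric])
  qed
  have 2: "(\<Prod>i<k. fact (2 * i) / fact (Suc k + i)) * fact (2 * k) =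
      (\<Prod>i<k. fact (2 * i) / fact (k + i)) * (fact k :: real)"
  proof -
    have "(\<Prod>i<m. fact (2 * i) / fact (Suc k + i)) * fact (k + m) =
      (\<Prod>i<m. fact (2 * i) / fact (k + i)) * (fact k :: real)" for m
    proof (induction m)
      case (Suc m)
      have "(\<Prod>i<Suc m. fact (2 * i) / fact (Suc k + i)) * fact (k + Suc m) =
          (\<Prod>i<m. fact (2 * i) / fact (Suc k + i)) * fact (k + m) * (fact (2 * m) / fact (k + m) :: real)"
        by simp
      also have "\<dots> = (\<Prod>i<Suc m. fact (2 * i) / fact (k + i)) * fact k"
        unfolding Suc.IH by simp
      finally show ?case .
    qed simp
    from this[of k] show ?thesis
      by (simp add: mult_2[symmetric])
  qed
  have "hook_coeff {..<Suc k} = hook_coeff {..<k} / fact (Suc k) *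
       (fact k * fact (Suc k) / fact (2 * k + 1))"
    using hook_coeff_insert[of "{..<k}" k] 1 by (simp add: lessThan_Suc)
  also have "\<dots> = (\<Prod>i<k. fact (2 * i) / fact (k + i)) * fact k / fact (2 * k + 1)"
    by (simp add: Suc.IH)
  also have "\<dots> = (\<Prod>i<Suc k. fact (2 * i) / fact (Suc k + i))"
    unfolding 2[symmetric] by (simp add: mult_2[symmetric])
  finally show ?case .
qed (simp add: hook_coeff_def)

section \<open>Counting walks\<close>

text \<open>Values beyond \<open>n\<close> are fixed to \<open>{}\<close> so that walks are determined by their first \<open>n + 1\<close> sets.\<close>

definition walks :: "nat \<Rightarrow> nat set \<Rightarrow> (nat \<Rightarrow> nat set) set" where
  "walks n S = {f. f 0 = {} \<and> f n = S \<and> (\<forall>j<n. step (f j) (f (Suc j))) \<and> (\<forall>j>n. f j = {})}"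

section \<open>Recursion over the last step of a walk\<close>

lemma walks_0: "walks 0 S = (if S = {} then {\<lambda>_. {}} else {})"
proof -
  have "f \<in> walks 0 S \<longleftrightarrow> S = {} \<and> f = (\<lambda>_. {})" for f
  proof
    assume f: "f \<in> walks 0 S"
    then have "f j = {}" for j
      by (cases j) (simp_all add: walks_def)
    then show "S = {} \<and> f = (\<lambda>_. {})"
      using f by (auto simp: walks_def)
  qed (simp add: walks_def)
  then have "walks 0 S = {f. S = {} \<and> f = (\<lambda>_. {})}"
    by blast
  then show ?thesis
    by (cases "S = {}") simp_all
qed

lemma walks_Suc: "walks (Suc n) S = (\<Union>T\<in>{T. step T S}. (\<lambda>f. f(Suc n := S)) ` walks n T)"
proof (intro equalityI subsetI)
  fix f assume f: "f \<in> walks (Suc n) S"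
  have "f = (f(Suc n := {}))(Suc n := S)"
    using f by (auto simp: walks_def fun_eq_iff)
  moreover have "f(Suc n := {}) \<in> walks n (f n)"
    using f by (auto simp: walks_def)
  moreover have "step (f n) S"
    using f by (auto simp: walks_def)
  ultimately show "f \<in> (\<Union>T\<in>{T. step T S}. (\<lambda>f. f(Suc n := S)) ` walks n T)"
    by blast
next
  fix f assume "f \<in> (\<Union>T\<in>{T. step T S}. (\<lambda>f. f(Suc n := S)) ` walks n T)"
  then obtain T g where g: "step T S" "g \<in> walks n T" "f = g(Suc n := S)"
    by blast
  have "step (f j) (f (Suc j))" if "j < Suc n" for j
    using that g by (cases "j = n") (auto simp: walks_def)
  then show "f \<in> walks (Suc n) S"
    using g by (auto simp: walks_def)
qed

lemma finite_walks: "finite (walks n S)"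
  by (induction n arbitrary: S) (auto simp: walks_0 walks_Suc finite_step)

lemma card_walks_Suc: "card (walks (Suc n) S) = (\<Sum>T | step T S. card (walks n T))"
proof -
  have inj: "inj_on (\<lambda>f. f(Suc n := S)) (walks n T)" for T
  proof (rule inj_onI)
    fix f g assume fg: "f \<in> walks n T" "g \<in> walks n T" "f(Suc n := S) = g(Suc n := S)"
    \<comment> \<open>Both values are \<open>{}\<close> since \<open>Suc n\<close> lies beyond the
      length \<open>n\<close>.\<close>
    then have "f (Suc n) = g (Suc n)"
      by (simp add: walks_def)
    then show "f = g"
      using fg(3) by (metis fun_upd_triv fun_upd_upd)
  qed
  have "card (walks (Suc n) S) = (\<Sum>T | step T S. card ((\<lambda>f. f(Suc n := S)) ` walks n T))"
    unfolding walks_Suc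
  proof (rule card_UN_disjoint)
    show "\<forall>T\<in>{T. step T S}. \<forall>U\<in>{T. step T S}. T \<noteq> U \<longrightarrow>
      (\<lambda>f. f(Suc n := S)) ` walks n T \<inter> (\<lambda>f. f(Suc n := S)) ` walks n U = {}"
    proof (intro ballI impI)
      fix T U :: "nat set" assume "T \<noteq> U"
      \<comment> \<open>The image remembers \<open>T\<close> as its value at \<open>n\<close>, which
        separates different \<open>T\<close>.\<close>
      have "h n = T" if "h \<in> (\<lambda>f. f(Suc n := S)) ` walks n T" for h T
        using that by (auto simp: walks_def)
      with \<open>T \<noteq> U\<close>
      show "(\<lambda>f. f(Suc n := S)) ` walks n T \<inter> (\<lambda>f. f(Suc n := S)) ` walks n U = {}"
        by blast
    qed
  qed (auto simp: finite_step finite_walks)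
  then show ?thesis
    by (simp add: card_image inj)
qed

lemma step_empty_iff: "step T {} \<longleftrightarrow> T = {}"
proof
  assume "step T {}"
  then show "T = {}"
    using step_subset[of T "{}" 0] by simp
qed (simp add: step_refl)

lemma card_walks_empty: "card (walks n {}) = 1"
  by (induction n) (simp_all add: walks_0 card_walks_Suc step_empty_iff)

text \<open>A degree bound with a prescribed coefficient, rather than an exact degree, lets the
  polynomials of the predecessors be added without discussing cancellation.\<close>

lemma card_walks_poly:
  assumes "finite S"
  shows "\<exists>p. degree p \<le> weight S \<and> coeff p (weight S) = hook_coeff S \<and>
    (\<forall>n. real (card (walks n S)) = poly p (real n))"
  using assms
proof (induction "weight S" arbitrary: S rule: less_induct)
  case less
  show ?case
  proof (cases "S = {}")
    case True
    then show ?thesis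
      by (intro exI[of _ 1]) (simp add: weight_def hook_coeff_def card_walks_empty)
  next
    case False
    \<comment> \<open>Staying at \<open>S\<close> reproduces the count for \<open>n\<close>, so the
      predecessors in \<open>B\<close> make up the forward difference.\<close>
    define B where "B = {T. step T S \<and> T \<noteq> S}"
    have finB: "finite B"
      unfolding B_def by (rule finite_subset[OF _ finite_step[of S]]) auto
    have insB: "{T. step T S} = insert S B"
      using less.prems by (auto simp: B_def step_refl)
    have lessB: "weight T < weight S" if "T \<in> B" for T
      using that weight_less by (simp add: B_def)
    have "\<forall>T\<in>B. \<exists>p. degree p \<le> weight T \<and> coeff p (weight T) = hook_coeff T \<and>
        (\<forall>n. real (card (walks n T)) = poly p (real n))"
      using less.hyps lessB by (auto simp: B_def step_def)
    then obtain P where P: "\<And>T. T \<in> B \<Longrightarrow> degree (P T) \<le> weight T"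
      "\<And>T. T \<in> B \<Longrightarrow> coeff (P T) (weight T) = hook_coeff T"
      "\<And>T n. T \<in> B \<Longrightarrow> real (card (walks n T)) = poly (P T) (real n)"
      by metis
    define Q where "Q = (\<Sum>T\<in>B. P T)"
    obtain d where d: "weight S = Suc d"
      using False less.prems by (cases "weight S") (auto simp: weight_def)
    have degP: "degree (P T) \<le> d" if "T \<in> B" for T
      using P(1)[OF that] lessB[OF that] d by simp
    have degQ: "degree Q \<le> d"
      unfolding Q_def by (rule degree_sum_le[OF finB degP])
    have "coeff Q d = (\<Sum>T\<in>B. coeff (P T) d)"
      by (simp add: Q_def coeff_sum)
    \<comment> \<open>Predecessors more than one box smaller have polynomials of degree below
      \<open>d\<close>.\<close>
    also have "\<dots> = (\<Sum>T\<in>{T. step T S \<and> weight S = Suc (weight T)}. coeff (P T) d)"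
    proof (rule sum.mono_neutral_right[OF finB])
      show "\<forall>T\<in>B - {T. step T S \<and> weight S = Suc (weight T)}. coeff (P T) d = 0"
      proof
        fix T assume T: "T \<in> B - {T. step T S \<and> weight S = Suc (weight T)}"
        then have "weight T < d"
          using lessB[of T] d by (auto simp: B_def)
        then have "degree (P T) < d"
          using P(1)[of T] T by simp
        then show "coeff (P T) d = 0"
          by (rule coeff_eq_0)
      qed
    qed (auto simp: B_def)
    also have "\<dots> = (\<Sum>T\<in>{T. step T S \<and> weight S = Suc (weight T)}. hook_coeff T)"
    proof (rule sum.cong)
      fix T assume "T \<in> {T. step T S \<and> weight S = Suc (weight T)}"
      then have "T \<in> B" "weight T = d"
        using d by (auto simp: B_def)
      then show "coeff (P T) d = hook_coeff T"
        using P(2)[of T] by simp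
    qed simp
    also have "\<dots> = (\<Sum>x\<in>removable S. hook_coeff (dec S x))"
      using less.prems by (simp add: step_weight_Suc_eq sum.reindex inj_on_dec)
    also have "\<dots> = real (Suc d) * hook_coeff S"
      using sum_hook_coeff_dec[OF less.prems] d by simp
    finally have coeffQ: "coeff Q d = real (Suc d) * hook_coeff S" .
    \<comment> \<open>The value \<open>0\<close> at \<open>0\<close> is the number of walks of
      length \<open>0\<close> to a nonempty set.\<close>
    obtain p where p: "degree p \<le> Suc d" "coeff p (Suc d) * of_nat (Suc d) = coeff Q d"
      "poly p 0 = 0" "\<And>x. poly p (x + 1) - poly p x = poly Q x"
      using forward_difference_surj[OF degQ, of 0] by blast
    have "coeff p (Suc d) = hook_coeff S"
      using p(2) coeffQ by simp
    moreover have "real (card (walks n S)) = poly p (real n)" for n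
    proof (induction n)
      case 0
      then show ?case
        using False p(3) by (simp add: walks_0)
    next
      case (Suc n)
      have "real (card (walks (Suc n) S)) = real (card (walks n S)) + (\<Sum>T\<in>B. real (card (walks n T)))"
        using finB by (simp add: card_walks_Suc insB) (simp add: B_def)
      also have "\<dots> = poly p (real n) + poly Q (real n)"
        using P(3) by (simp add: Suc.IH Q_def poly_sum)
      also have "\<dots> = poly p (real (Suc n))"
        using p(4)[of "real n"] by (simp add: add.commute)
      finally show ?case .
    qed
    ultimately show ?thesis
      using p(1) d by auto
  qed
qed

section \<open>Alternating sign matrices as walks\<close>

lemma alternates_in_sign_rev: "alternates_in_sign (rev xs) \<longleftrightarrow> alternates_in_sign xs"
proof -
  have "(\<lambda>x y :: int. sgn x = - sgn y) = (\<lambda>x y. sgn y = - sgn x)"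
    by (auto simp: fun_eq_iff)
  then show ?thesis
    unfolding alternates_in_sign_def successively_rev
    by (rule arg_cong[where f = "\<lambda>P. successively P xs"])
qed

lemma all_le_Suc: "(\<forall>m\<le>Suc n. P m) \<longleftrightarrow> P 0 \<and> (\<forall>m\<le>n. P (Suc m))"
  using All_less_Suc2[of "Suc n" P] by (simp add: less_Suc_eq_le)

text \<open>Here \<open>s\<close> is the sum accumulated before the list. To stay in
  \<open>{0, 1}\<close>, the next non-zero entry must be \<open>1\<close> at sum \<open>0\<close>
  and \<open>-1\<close> at sum \<open>1\<close>, which is \<open>1 - 2 * s\<close>; it then flips
  the sum.\<close>

lemma partial_sums_iff_alternates:
  fixes xs :: "int list"
  assumes "set xs \<subseteq> {-1, 0, 1}" "s \<in> {0, 1}"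
  defines "r \<equiv> filter (\<lambda>x. x \<noteq> 0) xs"
  shows "(\<forall>m\<le>length xs. s + sum_list (take m xs) \<in> {0, 1}) \<longleftrightarrow>
    alternates_in_sign r \<and> (r \<noteq> [] \<longrightarrow> hd r = 1 - 2 * s)"
  using assms(1,2) unfolding r_def
proof (induction xs arbitrary: s)
  case Nil
  then show ?case
    by (simp add: alternates_in_sign_def)
next
  case (Cons x xs)
  define f where "f = filter (\<lambda>x. x \<noteq> 0) xs"
  have hdf: "f \<noteq> [] \<Longrightarrow> hd f \<in> {-1, 1}"
    using Cons.prems(1) hd_in_set[of f] by (auto simp: f_def)
  have split: "(\<forall>m\<le>length (x # xs). s + sum_list (take m (x # xs)) \<in> {0, 1}) \<longleftrightarrow>
      s + x \<in> {0, 1} \<and> (\<forall>m\<le>length xs. (s + x) + sum_list (take m xs) \<in> {0, 1})"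
  proof -
    \<comment> \<open>The instance \<open>m = 0\<close> carries the condition on the new starting
      value.\<close>
    have "s + x \<in> {0, 1}" if "\<forall>m\<le>length xs. (s + x) + sum_list (take m xs) \<in> {0, 1}"
      using that[rule_format, of 0] by simp
    then show ?thesis
      using Cons.prems(2) unfolding length_Cons all_le_Suc by (auto simp: add.assoc)
  qed
  have IH: "(\<forall>m\<le>length xs. (s + x) + sum_list (take m xs) \<in> {0, 1}) \<longleftrightarrow>
     alternates_in_sign f \<and> (f \<noteq> [] \<longrightarrow> hd f = 1 - 2 * (s + x))" if "s + x \<in> {0, 1}"
    using Cons.IH[OF _ that] Cons.prems(1) by (simp add: f_def)
  have filter_Cons: "filter (\<lambda>x. x \<noteq> 0) (x # xs) = (if x = 0 then f else x # f)"
    by (simp add: f_def)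
  have alternates_Cons: "alternates_in_sign (x # f) \<longleftrightarrow>
      alternates_in_sign f \<and> (f \<noteq> [] \<longrightarrow> sgn (hd f) = - sgn x)"
    by (auto simp: alternates_in_sign_def successively_Cons)
  show ?case
  proof (cases "s + x \<in> {0, 1}")
    case True
    consider "x = 0" | "x = 1" "s = 0" | "x = -1" "s = 1"
      using True Cons.prems by auto
    then show ?thesis
      unfolding split filter_Cons IH[OF True] using True hdf alternates_Cons
      by cases auto
  next
    case False
    then have "x \<noteq> 0" "x \<noteq> 1 - 2 * s"
      using Cons.prems by auto
    then show ?thesis
      unfolding split filter_Cons using False by simp
  qed
qed

text \<open>The running sum is \<open>1\<close> after an entry \<open>1\<close> and \<open>0\<close>
  after an entry \<open>-1\<close>, so the final sum determines the last non-zero entry.\<close>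

lemma last_alternates:
  fixes xs :: "int list"
  assumes "set xs \<subseteq> {-1, 0, 1}"
  defines "r \<equiv> filter (\<lambda>x. x \<noteq> 0) xs"
  assumes "alternates_in_sign r" "r \<noteq> []" "hd r = 1 - 2 * s"
  shows "last r = 2 * (s + sum_list xs) - 1"
  using assms(1,3-) unfolding r_def
proof (induction xs arbitrary: s)
  case (Cons x xs)
  define f where "f = filter (\<lambda>x. x \<noteq> 0) xs"
  have hdf: "f \<noteq> [] \<Longrightarrow> hd f \<in> {-1, 1}"
    using Cons.prems(1) hd_in_set[of f] by (auto simp: f_def)
  have filter_Cons: "filter (\<lambda>x. x \<noteq> 0) (x # xs) = (if x = 0 then f else x # f)"
    by (simp add: f_def)
  show ?case
  proof (cases "f = []")
    case True
    have "sum_list xs = 0"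
      using True unfolding f_def by (induction xs) (auto split: if_splits)
    then show ?thesis
      using Cons.prems True unfolding filter_Cons by (auto split: if_splits)
  next
    case False
    have "alternates_in_sign f" "hd f = 1 - 2 * (s + x)"
      using Cons.prems False hdf unfolding filter_Cons
      by (auto simp: alternates_in_sign_def successively_Cons split: if_splits)
    then have "last f = 2 * ((s + x) + sum_list xs) - 1"
      using Cons.IH[of "s + x"] Cons.prems(1) False by (simp add: f_def)
    then show ?thesis
      using False unfolding filter_Cons by (simp add: add.assoc)
  qed
qed simp

section \<open>Prefix sums of rows and suffix sums of columns\<close>

lemma sum_list_take_list_of_vec:
  assumes "m \<le> dim_vec v"
  shows "sum_list (take m (list_of_vec v)) = (\<Sum>j<m. v $ j)"
  using assms by (simp add: list_of_vec_map take_map sum_set_upt_conv_sum_list_nat[symmetric] atLeast0LessThan)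

lemma sum_list_take_rev_list_of_vec:
  assumes "m \<le> dim_vec v"
  shows "sum_list (take m (rev (list_of_vec v))) = (\<Sum>j\<in>{dim_vec v - m..<dim_vec v}. v $ j)"
  using assms by (simp add: list_of_vec_map take_rev drop_map sum_list_rev
      sum_set_upt_conv_sum_list_nat[symmetric])

context
  fixes v :: "int vec"
  assumes entries: "\<And>i. i < dim_vec v \<Longrightarrow> v $ i \<in> {-1, 0, 1}"
begin

lemma set_list_of_vec_subset: "set (list_of_vec v) \<subseteq> {-1, 0, 1}"
proof
  fix x assume "x \<in> set (list_of_vec v)"
  then obtain i where "i < dim_vec v" "x = v $ i"
    by (auto simp: list_of_vec_map)
  then show "x \<in> {-1, 0, 1}"
    using entries by simp
qed

lemma nonzero_entries_eq_Nil_imp_sum_eq_0: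
  assumes "nonzero_entries v = []"
  shows "(\<Sum>j<dim_vec v. v $ j) = 0"
  using assms by (auto simp: nonzero_entries_def list_of_vec_map filter_empty_conv)

lemma prefix_sums_iff:
  "(\<forall>m\<le>dim_vec v. (\<Sum>j<m. v $ j) \<in> {0, 1}) \<longleftrightarrow>
    alternates_in_sign (nonzero_entries v) \<and>
    (nonzero_entries v \<noteq> [] \<longrightarrow> hd (nonzero_entries v) = 1)"
  using partial_sums_iff_alternates[OF set_list_of_vec_subset, of 0]
  by (simp add: nonzero_entries_def sum_list_take_list_of_vec)

text \<open>Columns are read from the bottom, so the list criterion is applied to the reversed list,
  whose prefixes are indexed by \<open>dim_vec v - m\<close>.\<close>

lemma suffix_sums_iff:
  "(\<forall>m\<le>dim_vec v. (\<Sum>j\<in>{m..<dim_vec v}. v $ j) \<in> {0, 1}) \<longleftrightarrow>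
    alternates_in_sign (nonzero_entries v) \<and>
    (nonzero_entries v \<noteq> [] \<longrightarrow> last (nonzero_entries v) = 1)"
proof -
  have "(\<forall>m\<le>dim_vec v. (\<Sum>j\<in>{m..<dim_vec v}. v $ j) \<in> {0, 1}) \<longleftrightarrow>
      (\<forall>m\<le>dim_vec v. (\<Sum>j\<in>{dim_vec v - m..<dim_vec v}. v $ j) \<in> {0, 1})"
    by (metis diff_diff_cancel diff_le_self)
  then show ?thesis
    using partial_sums_iff_alternates[of "rev (list_of_vec v)" 0] set_list_of_vec_subset
    by (simp add: nonzero_entries_def sum_list_take_rev_list_of_vec rev_filter[symmetric]
        alternates_in_sign_rev hd_rev)
qed

lemma last_nonzero_entries:
  assumes "alternates_in_sign (nonzero_entries v)" "nonzero_entries v \<noteq> []"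
    "hd (nonzero_entries v) = 1"
  shows "last (nonzero_entries v) = 2 * (\<Sum>j<dim_vec v. v $ j) - 1"
  using last_alternates[OF set_list_of_vec_subset, of 0] assms sum_list_take_list_of_vec[of "dim_vec v" v]
  by (simp add: nonzero_entries_def)

lemma hd_nonzero_entries:
  assumes "alternates_in_sign (nonzero_entries v)" "nonzero_entries v \<noteq> []"
    "last (nonzero_entries v) = 1"
  shows "hd (nonzero_entries v) = 2 * (\<Sum>j<dim_vec v. v $ j) - 1"
  using last_alternates[of "rev (list_of_vec v)" 0] set_list_of_vec_subset assms
    sum_list_take_list_of_vec[of "dim_vec v" v]
  by (simp add: nonzero_entries_def rev_filter[symmetric] alternates_in_sign_rev hd_rev last_rev)

end

text \<open>
  The extra conditions for \<open>k = n\<close> are automatic: the \<open>n\<close> column sums are at most \<open>1\<close> and add up to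
  the number \<open>n\<close> of rows.
\<close>

lemma rectangular_asm_iff_partial_sums:
  "rectangular_asm k n A \<longleftrightarrow> A \<in> carrier_mat k n \<and>
     (\<forall>i<k. \<forall>j<n. A $$ (i, j) \<in> {-1, 0, 1}) \<and>
     (\<forall>i<k. (\<forall>m\<le>n. (\<Sum>j<m. A $$ (i, j)) \<in> {0, 1}) \<and> (\<Sum>j<n. A $$ (i, j)) = 1) \<and>
     (\<forall>j<n. \<forall>m\<le>k. (\<Sum>i\<in>{m..<k}. A $$ (i, j)) \<in> {0, 1})"
proof (cases "A \<in> carrier_mat k n \<and> (\<forall>i<k. \<forall>j<n. A $$ (i, j) \<in> {-1, 0, 1})")
  case True
  then have A: "A \<in> carrier_mat k n" "\<And>i j. i < k \<Longrightarrow> j < n \<Longrightarrow> A $$ (i, j) \<in> {-1, 0, 1}"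
    by auto
  then have dims: "dim_row A = k" "dim_col A = n"
    by auto
  define r where "r i = nonzero_entries (row A i)" for i
  define c where "c j = nonzero_entries (col A j)" for j
  have row_sum: "(\<Sum>j<m. row A i $ j) = (\<Sum>j<m. A $$ (i, j))" if "i < k" "m \<le> n" for i m
    using that dims by (intro sum.cong) auto
  have col_sum: "(\<Sum>i\<in>I. col A j $ i) = (\<Sum>i\<in>I. A $$ (i, j))" if "j < n" "I \<subseteq> {..<k}" for j I
    using that dims by (intro sum.cong) (auto simp: subset_eq)
  have row: "(\<forall>m\<le>n. (\<Sum>j<m. A $$ (i, j)) \<in> {0, 1}) \<and> (\<Sum>j<n. A $$ (i, j)) = 1 \<longleftrightarrow>
      alternates_in_sign (r i) \<and> r i \<noteq> [] \<and> hd (r i) = 1 \<and> last (r i) = 1" if i: "i < k" for i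
  proof -
    have entries: "row A i $ j \<in> {-1, 0, 1}" if "j < dim_vec (row A i)" for j
      using that i dims A(2) by simp
    have "(\<forall>m\<le>n. (\<Sum>j<m. A $$ (i, j)) \<in> {0, 1}) \<longleftrightarrow>
      alternates_in_sign (r i) \<and> (r i \<noteq> [] \<longrightarrow> hd (r i) = 1)"
      using prefix_sums_iff[OF entries] i dims by (simp add: r_def row_sum)
    moreover have "last (r i) = 2 * (\<Sum>j<n. A $$ (i, j)) - 1"
      if "alternates_in_sign (r i)" "r i \<noteq> []" "hd (r i) = 1"
      using last_nonzero_entries[OF entries] that i dims by (simp add: r_def row_sum)
    moreover have "(\<Sum>j<n. A $$ (i, j)) = 0" if "r i = []"
      using nonzero_entries_eq_Nil_imp_sum_eq_0[OF entries] that i dims by (simp add: r_def row_sum)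
    \<comment> \<open>Row sum \<open>1\<close> excludes a zero row and otherwise amounts to the last
      non-zero entry being \<open>1\<close>.\<close>
    ultimately show ?thesis
      by (cases "r i = []") auto
  qed
  have entries: "col A j $ i \<in> {-1, 0, 1}" if "j < n" "i < dim_vec (col A j)" for i j
    using that dims A(2) by simp
  have col: "(\<forall>m\<le>k. (\<Sum>i\<in>{m..<k}. A $$ (i, j)) \<in> {0, 1}) \<longleftrightarrow>
      alternates_in_sign (c j) \<and> (c j \<noteq> [] \<longrightarrow> last (c j) = 1)" if j: "j < n" for j
    using suffix_sums_iff[OF entries[OF j]] j dims by (simp add: c_def col_sum subset_eq)
  have full: "c j \<noteq> [] \<and> hd (c j) = 1"
    if rows: "\<forall>i<k. (\<Sum>j<n. A $$ (i, j)) = 1"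
      and cols: "\<forall>j<n. \<forall>m\<le>k. (\<Sum>i\<in>{m..<k}. A $$ (i, j)) \<in> {0, 1}"
      and kn: "k = n" and j: "j < n" for j
  proof -
    define C where "C j = (\<Sum>i<k. A $$ (i, j))" for j
    have C: "C j \<in> {0, 1}" if "j < n" for j
      using cols[rule_format, OF that, of 0] by (simp add: C_def atLeast0LessThan)
    have "(\<Sum>j<n. C j) = (\<Sum>i<k. \<Sum>j<n. A $$ (i, j))"
      unfolding C_def by (rule sum.swap)
    also have "\<dots> = int n"
      using rows kn by simp
    finally have "(\<Sum>j<n. 1 - C j) = 0"
      by (simp add: sum_subtractf)
    moreover have "0 \<le> 1 - C j" if "j < n" for j
      using C[OF that] by auto
    ultimately have "1 - C j = 0"
      using sum_nonneg_eq_0_iff[of "{..<n}" "\<lambda>j. 1 - C j"] j by auto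
    then have sum1: "(\<Sum>i<dim_vec (col A j). col A j $ i) = 1"
      using j dims by (simp add: C_def col_sum)
    then have "c j \<noteq> []"
      using nonzero_entries_eq_Nil_imp_sum_eq_0[OF entries[OF j]] by (auto simp: c_def)
    moreover have "alternates_in_sign (c j)" "last (c j) = 1"
      using cols col[OF j] j calculation by auto
    ultimately show ?thesis
      using hd_nonzero_entries[OF entries[OF j]] sum1 by (simp add: c_def)
  qed
  have "rectangular_asm k n A \<longleftrightarrow>
      (\<forall>i<k. alternates_in_sign (r i) \<and> r i \<noteq> [] \<and> hd (r i) = 1 \<and> last (r i) = 1) \<and>
      (\<forall>j<n. alternates_in_sign (c j) \<and> (c j \<noteq> [] \<longrightarrow> last (c j) = 1) \<and>
        (k = n \<longrightarrow> c j \<noteq> [] \<and> hd (c j) = 1))"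
    unfolding rectangular_asm_def r_def c_def Let_def using True by blast
  also have "\<dots> \<longleftrightarrow>
      (\<forall>i<k. (\<forall>m\<le>n. (\<Sum>j<m. A $$ (i, j)) \<in> {0, 1}) \<and> (\<Sum>j<n. A $$ (i, j)) = 1) \<and>
      (\<forall>j<n. \<forall>m\<le>k. (\<Sum>i\<in>{m..<k}. A $$ (i, j)) \<in> {0, 1})"
    (is "_ \<longleftrightarrow> ?rows \<and> ?cols")
  proof (intro iffI conjI allI impI)
    fix j assume "?rows \<and> ?cols" "j < n"
    then show "alternates_in_sign (c j)" "c j \<noteq> [] \<Longrightarrow> last (c j) = 1"
      using col[of j] by (fact conjunct1 | metis)+
    show "c j \<noteq> []" "hd (c j) = 1" if "k = n"
      using full[of j] that \<open>?rows \<and> ?cols\<close> \<open>j < n\<close> by metis+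
  qed (use row col in \<open>metis+\<close>)
  finally show ?thesis
    using True by metis
qed (auto simp: rectangular_asm_def)

section \<open>The bijection between matrices and walks\<close>

lemma tail_card_eq_sum:
  assumes "S \<subseteq> {..<k}"
  shows "int (tail_card S m) = (\<Sum>i\<in>{m..<k}. of_bool (i \<in> S))"
proof -
  have "{m..<k} \<inter> {i. i \<in> S} = {x \<in> S. m \<le> x}"
    using assms by auto
  then show ?thesis
    by (simp add: tail_card_def sum_of_bool_eq)
qed

text \<open>The suffix sums are differences of tail counts; beyond \<open>k\<close> all tails are
  empty, so \<open>m \<le> k\<close> suffices.\<close>

lemma step_iff:
  assumes "T \<subseteq> {..<k}" "S \<subseteq> {..<k}"
  shows "step T S \<longleftrightarrow>
    (\<forall>m\<le>k. (\<Sum>i\<in>{m..<k}. of_bool (i \<in> S) - of_bool (i \<in> T)) \<in> {0, 1 :: int})"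
proof -
  have diff: "(\<Sum>i\<in>{m..<k}. of_bool (i \<in> S) - of_bool (i \<in> T)) = int (tail_card S m) - int (tail_card T m)" for m
    unfolding sum_subtractf tail_card_eq_sum[OF assms(1)] tail_card_eq_sum[OF assms(2)] ..
  have fin: "finite T" "finite S"
    using assms finite_subset by blast+
  have "tail_card S m = tail_card T m" if "\<not> m \<le> k" for m
  proof -
    have "int (tail_card S m) = 0" "int (tail_card T m) = 0"
      unfolding tail_card_eq_sum[OF assms(1)] tail_card_eq_sum[OF assms(2)] using that by simp_all
    then show ?thesis
      by simp
  qed
  then have "step T S \<longleftrightarrow>
     (\<forall>m\<le>k. tail_card S m = tail_card T m \<or> tail_card S m = tail_card T m + 1)"
    unfolding step_def using fin by blast
  also have "\<dots> \<longleftrightarrow> (\<forall>m\<le>k. int (tail_card S m) - int (tail_card T m) \<in> {0, 1})"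
    by (intro all_cong) auto
  finally show ?thesis
    unfolding diff .
qed

text \<open>Boundedness is passed backwards along the steps from the final set.\<close>

lemma walks_subset:
  assumes "f \<in> walks n {..<k}" "j \<le> n"
  shows "f j \<subseteq> {..<k}"
  using assms(2)
proof (induction j rule: inc_induct)
  case base
  then show ?case
    using assms(1) by (simp add: walks_def)
next
  case (step j)
  then have "step (f j) (f (Suc j))"
    using assms(1) by (simp add: walks_def)
  then show ?case
    using step.IH step_subset by blast
qed

text \<open>The value \<open>{}\<close> beyond \<open>n\<close> follows the convention of
  \<open>walks\<close>.\<close>

definition walk_of_asm :: "nat \<Rightarrow> nat \<Rightarrow> int mat \<Rightarrow> nat \<Rightarrow> nat set" where
  "walk_of_asm k n A j = (if j \<le> n then {i. i < k \<and> (\<Sum>l<j. A $$ (i, l)) = 1} else {})"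

definition asm_of_walk :: "nat \<Rightarrow> nat \<Rightarrow> (nat \<Rightarrow> nat set) \<Rightarrow> int mat" where
  "asm_of_walk k n f = mat k n (\<lambda>(i, j). of_bool (i \<in> f (Suc j)) - of_bool (i \<in> f j))"

lemma asm_of_walk_index:
  "i < k \<Longrightarrow> j < n \<Longrightarrow> asm_of_walk k n f $$ (i, j) = of_bool (i \<in> f (Suc j)) - of_bool (i \<in> f j)"
  by (simp add: asm_of_walk_def)

text \<open>The sum telescopes, and \<open>f 0 = {}\<close> removes the initial term.\<close>

lemma asm_of_walk_prefix_sum:
  assumes "f 0 = {}" "i < k" "j \<le> n"
  shows "(\<Sum>l<j. asm_of_walk k n f $$ (i, l)) = of_bool (i \<in> f j)"
proof -
  have "(\<Sum>l<j. asm_of_walk k n f $$ (i, l)) = (\<Sum>l<j. of_bool (i \<in> f (Suc l)) - of_bool (i \<in> f l))"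
    using assms by (intro sum.cong) (auto simp: asm_of_walk_index)
  also have "\<dots> = of_bool (i \<in> f j)"
    using assms(1) sum_lessThan_telescope[of "\<lambda>l. of_bool (i \<in> f l) :: int" j] by simp
  finally show ?thesis .
qed

text \<open>Row prefix sums are \<open>0\<close> or \<open>1\<close>, hence they are the indicators
  of the sets of the walk; an entry is the difference of two consecutive ones.\<close>

lemma asm_entry_eq_walk_diff:
  assumes "rectangular_asm k n A" "i < k" "j < n"
  shows "A $$ (i, j) = of_bool (i \<in> walk_of_asm k n A (Suc j)) - of_bool (i \<in> walk_of_asm k n A j)"
proof -
  have sums: "(\<Sum>l<m. A $$ (i, l)) = of_bool (i \<in> walk_of_asm k n A m)" if "m \<le> n" for m
  proof -
    have "(\<Sum>l<m. A $$ (i, l)) \<in> {0, 1}"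
      using assms(1,2) that by (simp add: rectangular_asm_iff_partial_sums)
    then show ?thesis
      using that assms(2) by (auto simp: walk_of_asm_def)
  qed
  show ?thesis
    using sums[of j] sums[of "Suc j"] assms(3) by simp
qed

text \<open>The column conditions give the steps, the row sums give the final set.\<close>

lemma walk_of_asm_in_walks:
  assumes "rectangular_asm k n A"
  shows "walk_of_asm k n A \<in> walks n {..<k}"
proof -
  have "step (walk_of_asm k n A j) (walk_of_asm k n A (Suc j))" if j: "j < n" for j
  proof (subst step_iff[of _ k])
    have "(\<Sum>i\<in>{m..<k}. A $$ (i, j)) \<in> {0, 1}" if "m \<le> k" for m
      using assms that j by (simp add: rectangular_asm_iff_partial_sums)
    moreover have "(\<Sum>i\<in>{m..<k}. A $$ (i, j)) = (\<Sum>i\<in>{m..<k}.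
        of_bool (i \<in> walk_of_asm k n A (Suc j)) - of_bool (i \<in> walk_of_asm k n A j))" for m
      using asm_entry_eq_walk_diff[OF assms _ j] by (intro sum.cong) auto
    ultimately show "\<forall>m\<le>k. (\<Sum>i\<in>{m..<k}.
        of_bool (i \<in> walk_of_asm k n A (Suc j)) - of_bool (i \<in> walk_of_asm k n A j)) \<in> {0, 1 :: int}"
      by simp
  qed (auto simp: walk_of_asm_def)
  moreover have "walk_of_asm k n A n = {..<k}"
    using assms by (auto simp: walk_of_asm_def rectangular_asm_iff_partial_sums)
  ultimately show ?thesis
    by (simp add: walks_def walk_of_asm_def)
qed

lemma asm_of_walk_rectangular_asm:
  assumes "f \<in> walks n {..<k}"
  shows "rectangular_asm k n (asm_of_walk k n f)"
  unfolding rectangular_asm_iff_partial_sums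
proof (intro conjI allI impI)
  have f: "f 0 = {}" "f n = {..<k}" "\<And>j. j < n \<Longrightarrow> step (f j) (f (Suc j))"
    using assms by (auto simp: walks_def)
  show "asm_of_walk k n f \<in> carrier_mat k n"
    by (simp add: asm_of_walk_def)
  show "asm_of_walk k n f $$ (i, j) \<in> {-1, 0, 1}" if "i < k" "j < n" for i j
    using that by (simp add: asm_of_walk_index)
  show "(\<Sum>j<m. asm_of_walk k n f $$ (i, j)) \<in> {0, 1}" if "i < k" "m \<le> n" for i m
    using that f(1) by (simp add: asm_of_walk_prefix_sum)
  show "(\<Sum>j<n. asm_of_walk k n f $$ (i, j)) = 1" if "i < k" for i
    using that f(1,2) by (simp add: asm_of_walk_prefix_sum)
  show "(\<Sum>i\<in>{m..<k}. asm_of_walk k n f $$ (i, j)) \<in> {0, 1}" if "j < n" "m \<le> k" for j m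
  proof -
    have "(\<Sum>i\<in>{m..<k}. asm_of_walk k n f $$ (i, j)) =
        (\<Sum>i\<in>{m..<k}. of_bool (i \<in> f (Suc j)) - of_bool (i \<in> f j))"
      using that by (intro sum.cong) (auto simp: asm_of_walk_index)
    then show ?thesis
      using step_iff[of "f j" k "f (Suc j)"] f(3)[OF that(1)] walks_subset[OF assms] that
      by simp
  qed
qed

lemma card_rectangular_asm: "card {A. rectangular_asm k n A} = card (walks n {..<k})"
proof (rule bij_betw_same_card)
  show "bij_betw (walk_of_asm k n) {A. rectangular_asm k n A} (walks n {..<k})"
  proof (rule bij_betw_byWitness[where f' = "asm_of_walk k n"])
    show "\<forall>A\<in>{A. rectangular_asm k n A}. asm_of_walk k n (walk_of_asm k n A) = A"
    proof
      fix A assume "A \<in> {A. rectangular_asm k n A}"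
      then have A: "rectangular_asm k n A"
        by simp
      then have "A \<in> carrier_mat k n"
        by (simp add: rectangular_asm_def)
      then show "asm_of_walk k n (walk_of_asm k n A) = A"
        using asm_entry_eq_walk_diff[OF A] by (intro eq_matI) (auto simp: asm_of_walk_def)
    qed
    show "\<forall>f\<in>walks n {..<k}. walk_of_asm k n (asm_of_walk k n f) = f"
    proof (intro ballI ext)
      fix f j assume f: "f \<in> walks n {..<k}"
      show "walk_of_asm k n (asm_of_walk k n f) j = f j"
      proof (cases "j \<le> n")
        case True
        have "f 0 = {}"
          using f by (simp add: walks_def)
        then show ?thesis
          using walks_subset[OF f True] True
          by (auto simp: walk_of_asm_def asm_of_walk_prefix_sum)
      next
        case False
        then show ?thesis
          using f by (simp add: walk_of_asm_def walks_def)
      qed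
    qed
  qed (auto simp: walk_of_asm_in_walks asm_of_walk_rectangular_asm)
qed

lemma weight_lessThan: "weight {..<k} = (k + 1) choose 2"
  by (induction k) (simp_all add: weight_def choose_two numeral_2_eq_2)

theorem corollary1p2:
  fixes k :: nat
  assumes "k \<ge> 1"
  shows "\<exists>p :: real poly.
    degree p = (k + 1) choose 2 \<and>
    lead_coeff p = (\<Prod>i = 0..k - 1. fact (2 * i) / fact (k + i)) \<and>
    (\<forall>n\<ge>k. real (card {A. rectangular_asm k n A}) = poly p (real n))"
proof -
  obtain p where p: "degree p \<le> weight {..<k}" "coeff p (weight {..<k}) = hook_coeff {..<k}"
    "\<And>n. real (card (walks n {..<k})) = poly p (real n)"
    using card_walks_poly[of "{..<k}"] by auto
  \<comment> \<open>A non-zero coefficient at the degree bound makes the degree exact.\<close>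
  have "hook_coeff {..<k} \<noteq> 0"
    by (simp add: hook_coeff_lessThan)
  then have "degree p = weight {..<k}"
    using p(1,2) by (metis le_degree le_antisym)
  \<comment> \<open>The truncated subtraction \<open>k - 1\<close> is harmless because
    \<open>k \<ge> 1\<close>.\<close>
  moreover have "{0..k - 1} = {..<k}"
    using assms by auto
  ultimately show ?thesis
    using p by (intro exI[of _ p]) (simp add: weight_lessThan hook_coeff_lessThan card_rectangular_asm)
qed

end
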